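(* Let $\ell\ge 2$ be an integer, and let $G$ be a triangle-free graph with no $5$-hole and no odd hole of length more than $2\ell+1$. Then $\chi(G)\le (\ell+1)4^{\ell-1}$.
   Context: All graphs are finite, without loops or parallel edges. A hole in $G$ is an induced subgraph which is a cycle of length (number of edges) at least four; an $n$-hole is a hole of length $n$; an odd hole is a hole of odd length. $\chi(G)$ is the chromatic number of $G$. *)

theory Defs
  imports "Graph_Theory.Graph_Theory"
begin

text \<open>
  A finite simple graph is a symmetric digraph in the sense of locale \<open>graph\<close>: finite, loopless,
  without parallel arcs; an undirected edge is a pair of opposite arcs. The library's notion of
  cycle for symmetric digraphs admits the closed walk through one edge and back, so the cycle
  graphs are defined here.
\<close>

definition cycle_graph :: "nat \<Rightarrow> ('a, 'b) pre_digraph \<Rightarrow> bool" where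
  "cycle_graph n H \<longleftrightarrow> graph H \<and> n \<ge> 3 \<and>
    (\<exists>xs. distinct xs \<and> length xs = n \<and> verts H = set xs \<and>
      arcs_ends H = (\<Union>i<n. {(xs ! i, xs ! (Suc i mod n)), (xs ! (Suc i mod n), xs ! i)}))"

definition hole :: "nat \<Rightarrow> ('a, 'b) pre_digraph \<Rightarrow> ('a, 'b) pre_digraph \<Rightarrow> bool" where
  "hole n H G \<longleftrightarrow> n \<ge> 4 \<and> induced_subgraph H G \<and> cycle_graph n H"

definition triangle_free :: "('a, 'b) pre_digraph \<Rightarrow> bool" where
  "triangle_free G \<longleftrightarrow> \<not> (\<exists>T. subgraph T G \<and> complete_digraph 3 T)"

definition proper_colouring :: "nat \<Rightarrow> ('a, 'b) pre_digraph \<Rightarrow> ('a \<Rightarrow> nat) \<Rightarrow> bool" where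
  "proper_colouring k G c \<longleftrightarrow>
    (\<forall>v \<in> verts G. c v < k) \<and> (\<forall>u v. (u, v) \<in> arcs_ends G \<longrightarrow> c u \<noteq> c v)"

definition chromatic_number :: "('a, 'b) pre_digraph \<Rightarrow> nat" where
  "chromatic_number G = (LEAST k. \<exists>c. proper_colouring k G c)"

lemma (in graph) chromatic_number_attained:
  "\<exists>c. proper_colouring (chromatic_number G) G c"
proof -
  obtain f where f: "bij_betw f (verts G) {0..<card (verts G)}"
    using ex_bij_betw_finite_nat[OF finite_verts] by blast
  have "proper_colouring (card (verts G)) G f"
    unfolding proper_colouring_def
  proof (intro conjI ballI allI impI)
    fix v assume "v \<in> verts G"
    then show "f v < card (verts G)"
      using bij_betwE[OF f] by simp
  next
    fix u v assume a: "(u, v) \<in> arcs_ends G"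
    then obtain e where e: "e \<in> arcs G" "tail G e = u" "head G e = v"
      by (rule reachableE)
    have "f (tail G e) \<noteq> f (head G e)"
      using no_loops[OF e(1)] tail_in_verts[OF e(1)] head_in_verts[OF e(1)]
        inj_on_eq_iff[OF bij_betw_imp_inj_on[OF f]] by simp
    then show "f u \<noteq> f v"
      unfolding e .
  qed
  then have "\<exists>k c. proper_colouring k G c"
    by (intro exI)
  then show ?thesis
    unfolding chromatic_number_def by (rule LeastI_ex)
qed

end

theory Submission
  imports Defs
begin

text \<open>
  The bound obtained is linear in \<open>l\<close>, with \<open>m = 2 * l - 2\<close> for \<open>l >
  2\<close> and \<open>m = 0\<close> for \<open>l = 2\<close>. Suppose all odd holes are shorter
  than \<open>m + 4\<close>. Take a component of high chromatic number inside one distance level of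
  \<open>G\<close>, and grow an induced path \<open>P\<close> with \<open>m\<close> edges into it,
  from a vertex \<open>q0\<close> one level above, such that a connected set \<open>C\<close> of
  still high chromatic number is attached to \<open>P\<close> only at its last vertex; both steps
  are cheap because neighbourhoods are stable. Call \<open>b\<close> a parent of a vertex of
  \<open>C\<close> if it is a neighbour one level above. Any induced path from \<open>q0\<close>
  along \<open>P\<close> and through \<open>C\<close> to a parent \<open>b\<close> closes, through
  the upper levels, to a hole that is long, hence even; so the parity of the length depends on
  \<open>b\<close> only, provided that neither a vertex of \<open>P\<close> nor a fixed parent
  \<open>t\<close> of \<open>q0\<close> is adjacent to \<open>b\<close>. The exceptional vertices of
  \<open>C\<close> lie in \<open>m + 2\<close> second neighbourhoods, which are stable since there
  is no triangle and no pentagon. The others are 2-coloured by the parity of the least distance,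
  within \<open>C\<close>, from \<open>P\<close> to a neighbour of one of their parents: for
  adjacent vertices of equal parity there would be two induced paths of different parity to the same
  parent.
\<close>

section \<open>Components, colourings, levellings and induced paths for an adjacency
  relation\<close>

locale adjacency =
  fixes adj :: "'a \<Rightarrow> 'a \<Rightarrow> bool"
  assumes adj_sym: "adj u v \<Longrightarrow> adj v u"
    and adj_irrefl: "\<not> adj u u"
begin

lemma adj_commute: "adj u v \<longleftrightarrow> adj v u"
  using adj_sym by blast

definition edges_in :: "'a set \<Rightarrow> ('a \<times> 'a) set" where
  "edges_in S = {(u, v). u \<in> S \<and> v \<in> S \<and> adj u v}"

definition component :: "'a set \<Rightarrow> 'a \<Rightarrow> 'a set" where
  "component S x = {y. (x, y) \<in> (edges_in S)\<^sup>*}"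

definition colourable :: "'a set \<Rightarrow> nat \<Rightarrow> bool" where
  "colourable S n \<longleftrightarrow>
    (\<exists>c. (\<forall>v\<in>S. c v < n) \<and> (\<forall>u\<in>S. \<forall>v\<in>S. adj u v \<longrightarrow> c u \<noteq> c v))"

definition stable :: "'a set \<Rightarrow> bool" where
  "stable S \<longleftrightarrow> (\<forall>u\<in>S. \<forall>v\<in>S. \<not> adj u v)"

text \<open>Each vertex is tested against the later ones only, which suffices by symmetry. For a
  single vertex the quantifier ranges over the empty set, so the value \<open>hd []\<close> never
  matters.\<close>

primrec induced_path :: "'a list \<Rightarrow> bool" where
  "induced_path [] \<longleftrightarrow> True"
| "induced_path (x # xs) \<longleftrightarrow>
    x \<notin> set xs \<and> (\<forall>y\<in>set xs. adj x y \<longleftrightarrow> y = hd xs) \<and> induced_path xs"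

definition induced_cycle :: "'a list \<Rightarrow> bool" where
  "induced_cycle xs \<longleftrightarrow> length xs \<ge> 4 \<and> distinct xs \<and>
    (\<forall>i j. i < j \<longrightarrow> j < length xs \<longrightarrow>
      (adj (xs ! i) (xs ! j) \<longleftrightarrow> j = Suc i \<or> i = 0 \<and> Suc j = length xs))"

text \<open>On \<open>S\<close> these local conditions force \<open>d\<close> to be the distance
  from \<open>r\<close> in the graph induced on \<open>S\<close>; in particular \<open>S\<close> is
  connected. Levels with smaller \<open>d\<close> are thought of as higher.\<close>

definition levelling :: "'a set \<Rightarrow> 'a \<Rightarrow> ('a \<Rightarrow> nat) \<Rightarrow> bool" where
  "levelling S r d \<longleftrightarrow> r \<in> S \<and> (\<forall>y\<in>S. d y = 0 \<longleftrightarrow> y = r) \<and>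
    (\<forall>y\<in>S. \<forall>z\<in>S. adj y z \<longrightarrow> d z \<le> Suc (d y)) \<and>
    (\<forall>y\<in>S. \<forall>n. d y = Suc n \<longrightarrow> (\<exists>z\<in>S. adj y z \<and> d z = n))"

lemma edges_in_rtrancl_mem: "(x, y) \<in> (edges_in S)\<^sup>* \<Longrightarrow> x \<in> S \<Longrightarrow> y \<in> S"
  by (induction rule: rtrancl_induct) (auto simp: edges_in_def)

lemma sym_edges_in_rtrancl: "(x, y) \<in> (edges_in S)\<^sup>* \<Longrightarrow> (y, x) \<in> (edges_in S)\<^sup>*"
proof -
  have "sym (edges_in S)"
    by (auto simp: edges_in_def sym_def intro: adj_sym)
  then show "(x, y) \<in> (edges_in S)\<^sup>* \<Longrightarrow> (y, x) \<in> (edges_in S)\<^sup>*"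
    using sym_rtrancl symD by metis
qed

lemma edges_in_mono: "S \<subseteq> T \<Longrightarrow> (edges_in S)\<^sup>* \<subseteq> (edges_in T)\<^sup>*"
  by (rule rtrancl_mono) (auto simp: edges_in_def)

lemma component_subset: "x \<in> S \<Longrightarrow> component S x \<subseteq> S"
  using edges_in_rtrancl_mem by (auto simp: component_def)

lemma component_refl: "x \<in> component S x"
  by (simp add: component_def)

lemma component_closed:
  assumes "x \<in> S" "y \<in> component S x" "z \<in> S" "adj y z"
  shows "z \<in> component S x"
proof -
  have "(y, z) \<in> edges_in S"
    using assms component_subset[OF assms(1)] by (auto simp: edges_in_def)
  then show ?thesis
    using assms(2) by (auto simp: component_def)
qed

lemma component_connected:
  assumes "x \<in> S" "y \<in> component S x"
  shows "(x, y) \<in> (edges_in (component S x))\<^sup>*"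
proof -
  have "(x, y) \<in> (edges_in S)\<^sup>*"
    using assms(2) by (simp add: component_def)
  then show ?thesis
  proof (induction rule: rtrancl_induct)
    case (step y z)
    have "y \<in> component S x" "z \<in> component S x"
      using step.hyps by (auto simp: component_def)
    then have "(y, z) \<in> edges_in (component S x)"
      using step.hyps(2) by (auto simp: edges_in_def)
    then show ?case
      using step.IH by simp
  qed simp
qed

lemma crossing_edge:
  assumes "(x, y) \<in> (edges_in S)\<^sup>*" "x \<notin> K" "y \<in> K"
  obtains u v where "u \<in> S" "u \<notin> K" "v \<in> K" "adj u v"
proof -
  have "x \<notin> K \<Longrightarrow> y \<in> K \<Longrightarrow> \<exists>u v. u \<in> S \<and> u \<notin> K \<and> v \<in> K \<and> adj u v"
    using assms(1)
    by (induction rule: rtrancl_induct) (auto simp: edges_in_def)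
  then show thesis
    using that assms by blast
qed

lemma colourable_mono: "colourable T n \<Longrightarrow> S \<subseteq> T \<Longrightarrow> n \<le> k \<Longrightarrow> colourable S k"
  unfolding colourable_def by (elim exE, intro exI) (auto dest: subsetD intro: order_less_le_trans)

lemma colourable_Un:
  assumes "colourable S a" "colourable T b"
  shows "colourable (S \<union> T) (a + b)"
proof -
  obtain c where c: "\<forall>v\<in>S. c v < a" "\<forall>u\<in>S. \<forall>v\<in>S. adj u v \<longrightarrow> c u \<noteq> c v"
    using assms(1) by (auto simp: colourable_def)
  obtain c' where c': "\<forall>v\<in>T. c' v < b" "\<forall>u\<in>T. \<forall>v\<in>T. adj u v \<longrightarrow> c' u \<noteq> c' v"
    using assms(2) by (auto simp: colourable_def)
  let ?c = "\<lambda>v. if v \<in> S then c v else a + c' v"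
  have "?c v < a + b" if "v \<in> S \<union> T" for v
    using c(1) c'(1) that by (auto simp: trans_less_add1)
  moreover have "?c u \<noteq> ?c v" if "u \<in> S \<union> T" "v \<in> S \<union> T" "adj u v" for u v
  proof (cases "u \<in> S \<longleftrightarrow> v \<in> S")
    case True
    then show ?thesis using c(2) c'(2) that by auto
  next
    case False
    then have "u \<in> S \<and> c u < a \<and> v \<notin> S \<or> v \<in> S \<and> c v < a \<and> u \<notin> S"
      using c(1) by blast
    then show ?thesis by auto
  qed
  ultimately show ?thesis
    unfolding colourable_def by (intro exI[of _ ?c] conjI ballI impI)
qed

lemma stable_colourable: "stable S \<Longrightarrow> colourable S 1"
  by (auto simp: colourable_def stable_def)

lemma colourable_stable_cover:
  assumes "\<forall>T\<in>set Ts. stable T"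
  shows "colourable (\<Union>(set Ts)) (length Ts)"
  using assms
proof (induction Ts)
  case Nil
  show ?case by (simp add: colourable_def)
next
  case (Cons T Ts)
  then show ?case
    using colourable_Un[OF stable_colourable, of T "\<Union>(set Ts)" "length Ts"] by simp
qed

text \<open>Colourings of the components combine, as no edge joins two components. The chosen
  colourings are indexed by the component as a set, so that all its vertices use the same
  one.\<close>

lemma uncolourable_component:
  assumes "\<not> colourable S n"
  obtains x where "x \<in> S" "\<not> colourable (component S x) n"
proof (rule ccontr)
  assume "\<not> thesis"
  then have "\<forall>x\<in>S. colourable (component S x) n"
    using that by blast
  then have "\<forall>K\<in>component S ` S. \<exists>c. (\<forall>v\<in>K. c v < n) \<and> (\<forall>u\<in>K. \<forall>v\<in>K. adj u v \<longrightarrow> c u \<noteq> c v)"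
    unfolding colourable_def by blast
  then obtain f where f: "\<forall>K\<in>component S ` S. (\<forall>v\<in>K. f K v < n) \<and>
      (\<forall>u\<in>K. \<forall>v\<in>K. adj u v \<longrightarrow> f K u \<noteq> f K v)"
    unfolding bchoice_iff by blast
  have "component S u = component S v" if "u \<in> S" "v \<in> S" "adj u v" for u v
  proof -
    have "(u, v) \<in> (edges_in S)\<^sup>*" "(v, u) \<in> (edges_in S)\<^sup>*"
      using that adj_sym by (auto simp: edges_in_def)
    then show ?thesis
      by (auto simp: component_def)
  qed
  then have "colourable S n"
    unfolding colourable_def using f component_refl
    by (intro exI[of _ "\<lambda>v. f (component S v) v"]) (metis image_eqI)
  then show False
    using assms by simp
qed

lemma levelling_exists:
  assumes "r \<in> S" "\<And>y. y \<in> S \<Longrightarrow> (r, y) \<in> (edges_in S)\<^sup>*"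
  obtains d where "levelling S r d"
proof -
  define d where "d y = (LEAST n. (r, y) \<in> edges_in S ^^ n)" for y
  have reach: "(r, y) \<in> edges_in S ^^ d y" if y: "y \<in> S" for y
  proof -
    have "\<exists>n. (r, y) \<in> edges_in S ^^ n"
      using assms(2)[OF y] rtrancl_imp_relpow by blast
    then show ?thesis
      unfolding d_def by (rule LeastI_ex)
  qed
  have least: "d y \<le> n" if "(r, y) \<in> edges_in S ^^ n" for y n
    unfolding d_def using that by (rule Least_le)
  have step: "d z \<le> Suc (d y)" if "y \<in> S" "z \<in> S" "adj y z" for y z
    using least[of z "Suc (d y)"] reach[of y] that by (auto simp: edges_in_def)
  have "levelling S r d"
    unfolding levelling_def
  proof (intro conjI ballI allI impI)
    show "r \<in> S" by fact
    show "d y = 0 \<longleftrightarrow> y = r" if "y \<in> S" for y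
      using reach[OF that] least[of r 0] by auto
    show "d z \<le> Suc (d y)" if "y \<in> S" "z \<in> S" "adj y z" for y z
      using step that by blast
    show "\<exists>z\<in>S. adj y z \<and> d z = n" if y: "y \<in> S" "d y = Suc n" for y n
    proof -
      have "(r, y) \<in> edges_in S ^^ Suc n"
        using reach[OF y(1)] y(2) by simp
      then obtain z where z: "(r, z) \<in> edges_in S ^^ n" "(z, y) \<in> edges_in S"
        by auto
      then have "z \<in> S" "adj z y"
        by (auto simp: edges_in_def)
      then have "d z = n"
        using least[OF z(1)] step[of z y] y by simp
      then show ?thesis
        using \<open>z \<in> S\<close> \<open>adj z y\<close> adj_sym by blast
    qed
  qed
  then show thesis
    by (rule that)
qed

lemma levelling_parent:
  assumes "levelling S r d" "y \<in> S" "y \<noteq> r"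
  obtains z where "z \<in> S" "adj y z" "Suc (d z) = d y"
proof -
  obtain n where "d y = Suc n"
    using assms by (metis levelling_def not0_implies_Suc)
  then show thesis
    using assms that by (metis levelling_def)
qed

lemma levelling_step: "levelling S r d \<Longrightarrow> y \<in> S \<Longrightarrow> z \<in> S \<Longrightarrow> adj y z \<Longrightarrow> d z \<le> Suc (d y)"
  by (auto simp: levelling_def)

lemma levelling_0: "levelling S r d \<Longrightarrow> y \<in> S \<Longrightarrow> d y = 0 \<longleftrightarrow> y = r"
  by (auto simp: levelling_def)

text \<open>Edges stay inside a level or join consecutive ones. So all levels of one parity can
  share a palette of \<open>n\<close> colours, and the parity of the level, kept as the last bit of
  the colour, separates the two palettes.\<close>

lemma levels_colourable:
  assumes "levelling S r d" "\<And>k. colourable {y \<in> S. d y = k} n"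
  shows "colourable S (2 * n)"
proof -
  have "\<forall>k. \<exists>c. (\<forall>v\<in>{y \<in> S. d y = k}. c v < n) \<and>
      (\<forall>u\<in>{y \<in> S. d y = k}. \<forall>v\<in>{y \<in> S. d y = k}. adj u v \<longrightarrow> c u \<noteq> c v)"
    using assms(2) unfolding colourable_def by (rule allI)
  from choice[OF this] obtain c where c: "\<forall>k. (\<forall>v\<in>{y \<in> S. d y = k}. c k v < n) \<and>
      (\<forall>u\<in>{y \<in> S. d y = k}. \<forall>v\<in>{y \<in> S. d y = k}. adj u v \<longrightarrow> c k u \<noteq> c k v)" ..
  let ?c = "\<lambda>v. 2 * c (d v) v + d v mod 2"
  have "?c v < 2 * n" if "v \<in> S" for v
    proof -
    have "c (d v) v < n"
      using c[rule_format, of "d v"] that by simp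
    then show ?thesis
      by linarith
  qed
  moreover have "?c u \<noteq> ?c v" if uv: "u \<in> S" "v \<in> S" "adj u v" for u v
  proof (cases "d u = d v")
    case True
    then show ?thesis
      using c[rule_format, of "d v"] uv by simp
  next
    case False
    then have "d u = Suc (d v) \<or> d v = Suc (d u)"
      using levelling_step[OF assms(1)] uv adj_sym by (metis le_SucE le_antisym)
    then have "d u mod 2 \<noteq> d v mod 2"
      by (auto simp: mod_Suc split: if_splits)
    moreover have "?c u mod 2 = d u mod 2" "?c v mod 2 = d v mod 2"
      by simp_all
    ultimately show ?thesis
      by metis
  qed
  ultimately show ?thesis
    unfolding colourable_def by (intro exI[of _ ?c] conjI ballI impI)
qed

lemma induced_path_append:
  "induced_path (xs @ ys) \<longleftrightarrow> induced_path xs \<and> induced_path ys \<and> set xs \<inter> set ys = {} \<and>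
    (\<forall>x\<in>set xs. \<forall>y\<in>set ys. adj x y \<longleftrightarrow> x = last xs \<and> y = hd ys)"
proof (induction xs)
  case (Cons x xs)
  show ?case
  proof (cases "xs = []")
    case False
    then have hd: "hd (xs @ ys) = hd xs" "hd xs \<in> set xs" "last (x # xs) = last xs" "last xs \<in> set xs"
      by simp_all
    have 1: "(\<forall>y\<in>set xs \<union> set ys. adj x y \<longleftrightarrow> y = hd xs) \<longleftrightarrow>
        (\<forall>y\<in>set xs. adj x y \<longleftrightarrow> y = hd xs) \<and> (\<forall>y\<in>set ys. \<not> adj x y)"
      if "set xs \<inter> set ys = {}"
      using hd(2) that by auto
    have 2: "(\<forall>y\<in>set ys. adj x y \<longleftrightarrow> x = last xs \<and> y = hd ys) \<longleftrightarrow> (\<forall>y\<in>set ys. \<not> adj x y)"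
      if "x \<notin> set xs"
      using hd(4) that by auto
    show ?thesis
      using Cons.IH 1 2 hd(1,3) by auto
  qed auto
qed simp

lemma induced_path_snoc:
  "induced_path (xs @ [y]) \<longleftrightarrow>
    induced_path xs \<and> y \<notin> set xs \<and> (\<forall>x\<in>set xs. adj x y \<longleftrightarrow> x = last xs)"
  by (auto simp: induced_path_append)

lemma induced_path_distinct: "induced_path xs \<Longrightarrow> distinct xs"
  by (induction xs) auto

lemma induced_path_nth:
  "induced_path xs \<Longrightarrow> i < j \<Longrightarrow> j < length xs \<Longrightarrow> adj (xs ! i) (xs ! j) \<longleftrightarrow> j = Suc i"
proof (induction xs arbitrary: i j)
  case (Cons x xs)
  obtain j' where j: "j = Suc j'"
    using Cons.prems(2) by (cases j) auto
  show ?case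
  proof (cases i)
    case 0
    have "xs ! j' = hd xs \<longleftrightarrow> j' = 0"
    proof -
      have "distinct xs" "j' < length xs" "0 < length xs"
        using induced_path_distinct[of xs] Cons.prems j by auto
      then show ?thesis
        by (simp add: hd_conv_nth nth_eq_iff_index_eq)
    qed
    then show ?thesis
      using Cons.prems j 0 by simp
  next
    case (Suc i')
    then show ?thesis
      using Cons.IH[of i' j'] Cons.prems j by simp
  qed
qed simp

text \<open>A cycle is assembled from two induced paths. The second may be a single vertex: then
  \<open>hd ys = last ys\<close> is joined to both ends of \<open>T\<close>.\<close>

lemma induced_cycle_append:
  assumes T: "induced_path T" and ys: "induced_path ys"
    and len: "length T \<ge> 2" "ys \<noteq> []" "length T + length ys \<ge> 4"
    and disj: "set T \<inter> set ys = {}"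
    and cross: "\<And>x y. x \<in> set T \<Longrightarrow> y \<in> set ys \<Longrightarrow>
      adj x y \<longleftrightarrow> x = last T \<and> y = hd ys \<or> x = hd T \<and> y = last ys"
  shows "induced_cycle (T @ ys)"
  unfolding induced_cycle_def
proof (intro conjI allI impI)
  show "4 \<le> length (T @ ys)" using len by simp
  show dist: "distinct (T @ ys)"
    using T ys disj induced_path_distinct by auto
  fix i j assume ij: "i < j" "j < length (T @ ys)"
  consider "j < length T" | "length T \<le> i" | "i < length T" "length T \<le> j"
    by linarith
  then show "adj ((T @ ys) ! i) ((T @ ys) ! j) \<longleftrightarrow> j = Suc i \<or> i = 0 \<and> Suc j = length (T @ ys)"
  proof cases
    case 1
    then show ?thesis
      using induced_path_nth[OF T ij(1)] ij len(2) by (cases ys) (auto simp: nth_append)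
  next
    case 2
    then show ?thesis
      using induced_path_nth[OF ys, of "i - length T" "j - length T"] ij len
      by (auto simp: nth_append)
  next
    case 3
    have ne: "T \<noteq> []" using 3 by auto
    have j: "j - length T < length ys"
      using ij 3 by auto
    have "T ! i = last T \<longleftrightarrow> Suc i = length T"
      using 3(1) ne dist by (auto simp: last_conv_nth nth_eq_iff_index_eq)
    moreover have "T ! i = hd T \<longleftrightarrow> i = 0"
      using 3(1) ne dist by (auto simp: hd_conv_nth nth_eq_iff_index_eq)
    moreover have "ys ! (j - length T) = last ys \<longleftrightarrow> Suc j = length (T @ ys)"
    proof -
      have "last ys = ys ! (length ys - 1)"
        using len(2) by (rule last_conv_nth)
      moreover have "length ys - 1 < length ys"
        using len(2) by simp
      ultimately have "ys ! (j - length T) = last ys \<longleftrightarrow> j - length T = length ys - 1"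
        using j dist by (simp add: nth_eq_iff_index_eq)
      then show ?thesis
        using j 3(2) by simp linarith
    qed
    moreover have "ys ! (j - length T) = hd ys \<longleftrightarrow> j = length T"
      using j 3(2) len(2) dist by (auto simp: hd_conv_nth nth_eq_iff_index_eq)
    moreover have "(T @ ys) ! i = T ! i" "(T @ ys) ! j = ys ! (j - length T)"
      using 3 by (simp_all add: nth_append)
    ultimately have "adj ((T @ ys) ! i) ((T @ ys) ! j) \<longleftrightarrow>
        Suc i = length T \<and> j = length T \<or> i = 0 \<and> Suc j = length (T @ ys)"
      using cross[of "T ! i" "ys ! (j - length T)"] j 3 by simp
    then show ?thesis
      using 3 by auto
  qed
qed

text \<open>A path to a predecessor \<open>z\<close> of \<open>y\<close> is extended by
  \<open>y\<close>. Its other vertices have distance below \<open>d z\<close>, at least two less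
  than \<open>d y\<close>, so they are not adjacent to \<open>y\<close>; this is why the strict
  bound on \<open>d\<close> is part of the induction.\<close>

lemma levelling_induced_path:
  assumes "levelling S r d" "y \<in> S"
  shows "\<exists>xs. xs \<noteq> [] \<and> induced_path xs \<and> hd xs = r \<and> last xs = y \<and> set xs \<subseteq> S \<and>
    (\<forall>x\<in>set xs. x \<noteq> y \<longrightarrow> d x < d y)"
  using assms(2)
proof (induction "d y" arbitrary: y rule: less_induct)
  case less
  show ?case
  proof (cases "y = r")
    case True
    then show ?thesis
      using less.prems by (intro exI[of _ "[r]"]) auto
  next
    case False
    then obtain z where z: "z \<in> S" "adj y z" "Suc (d z) = d y"
      using levelling_parent[OF assms(1) less.prems] by blast
    then obtain xs where xs: "xs \<noteq> []" "induced_path xs" "hd xs = r" "last xs = z" "set xs \<subseteq> S"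
      "\<forall>x\<in>set xs. x \<noteq> z \<longrightarrow> d x < d z"
      using less.hyps[of z] by auto
    have "adj x y \<longleftrightarrow> x = z" if "x \<in> set xs" for x
    proof
      assume "adj x y"
      then have "d y \<le> Suc (d x)"
        using levelling_step[OF assms(1)] that xs(5) less.prems by blast
      then show "x = z"
        using xs(6) that z(3) by fastforce
    next
      assume "x = z"
      then show "adj x y"
        using z(2) adj_sym by simp
    qed
    moreover have "y \<notin> set xs"
      using xs z by auto
    ultimately have "induced_path (xs @ [y])"
      using xs by (auto simp: induced_path_snoc)
    then show ?thesis
      using xs z less.prems by (intro exI[of _ "xs @ [y]"]) auto
  qed
qed

lemma rtrancl_induced_path:
  assumes "(x, y) \<in> (edges_in S)\<^sup>*" "x \<in> S"
  obtains xs where "xs \<noteq> []" "induced_path xs" "hd xs = x" "last xs = y" "set xs \<subseteq> S"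
proof -
  obtain d where "levelling (component S x) x d"
    using levelling_exists[OF component_refl component_connected[OF assms(2)]] .
  moreover have "y \<in> component S x"
    using assms(1) by (simp add: component_def)
  ultimately have "\<exists>xs. xs \<noteq> [] \<and> induced_path xs \<and> hd xs = x \<and> last xs = y \<and>
      set xs \<subseteq> component S x \<and> (\<forall>z\<in>set xs. z \<noteq> y \<longrightarrow> d z < d y)"
    by (rule levelling_induced_path)
  then obtain xs where xs: "xs \<noteq> []" "induced_path xs" "hd xs = x" "last xs = y"
    "set xs \<subseteq> component S x"
    by blast
  then have "set xs \<subseteq> S"
    using component_subset[OF assms(2)] by blast
  with xs(1-4) show thesis
    by (rule that)
qed

end

section \<open>Consequences of excluding triangles, pentagons and long odd holes\<close>

locale odd_hole_bounded = adjacency adj for adj :: "'a \<Rightarrow> 'a \<Rightarrow> bool" +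
  fixes m :: nat
  assumes triangle: "adj a b \<Longrightarrow> adj b c \<Longrightarrow> \<not> adj c a"
    and induced_pentagon: "induced_cycle xs \<Longrightarrow> length xs \<noteq> 5"
    and long_induced_cycle_even: "induced_cycle xs \<Longrightarrow> length xs \<ge> m + 4 \<Longrightarrow> even (length xs)"
begin

text \<open>Excludes every closed walk of length five: without triangles such a walk has no repeated
  vertex and no chord, so it would be an induced cycle.\<close>

lemma pentagon:
  assumes "adj a b" "adj b c" "adj c d" "adj d e"
  shows "\<not> adj e a"
proof
  assume "adj e a"
  note edges = assms this
  have chords: "\<not> adj a c" "\<not> adj a d" "\<not> adj b d" "\<not> adj b e" "\<not> adj c e"
    using edges triangle adj_sym by blast+
  have "distinct [a, b, c, d, e]"
    using edges chords adj_sym adj_irrefl by auto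
  moreover from this have "induced_path [a, b, c, d]"
    using edges chords by auto
  ultimately have "induced_cycle ([a, b, c, d] @ [e])"
    using edges chords adj_sym[OF \<open>adj e a\<close>] by (intro induced_cycle_append) auto
  then show False
    using induced_pentagon by fastforce
qed

lemma stable_neighbours: "stable {w. adj p w}"
  unfolding stable_def using triangle adj_sym by blast

text \<open>An edge inside the set would give a closed walk of length five through \<open>p\<close>.
  The two intermediate neighbours may coincide, as \<open>pentagon\<close> covers walks.\<close>

lemma stable_second_neighbours: "stable {w. \<exists>a. adj w a \<and> adj a p}"
  unfolding stable_def
proof (intro ballI notI)
  fix w w' assume w: "w \<in> {w. \<exists>a. adj w a \<and> adj a p}" "w' \<in> {w. \<exists>a. adj w a \<and> adj a p}"
    and ww': "adj w w'"
  then obtain a a' where "adj w a" "adj a p" "adj w' a'" "adj a' p"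
    by blast
  then show False
    using pentagon[of p a w w' a'] ww' adj_sym by blast
qed

end

section \<open>The path entering a level, and the parity of induced paths to a clean vertex\<close>

locale path_into_level = odd_hole_bounded adj m for adj :: "'a \<Rightarrow> 'a \<Rightarrow> bool" and m +
  fixes W :: "'a set" and z0 :: 'a and d :: "'a \<Rightarrow> nat" and h :: nat and q0 t :: 'a
    and P :: "'a list" and C :: "'a set" and e :: "'a \<Rightarrow> nat"
  assumes lev_W: "levelling W z0 d"
    and C_level: "w \<in> C \<Longrightarrow> w \<in> W \<and> d w = Suc (Suc h)"
    and q0: "q0 \<in> W" "d q0 = Suc h"
    and t: "t \<in> W" "d t = h" "adj q0 t"
    and P: "P \<noteq> []" "induced_path P" "length P = Suc m" "hd P = q0"
    and P_level: "p \<in> set P \<Longrightarrow> p \<noteq> q0 \<Longrightarrow> p \<in> W \<and> d p = Suc (Suc h)"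
    and P_C_disjoint: "C \<inter> set P = {}"
    and P_C: "p \<in> set P \<Longrightarrow> w \<in> C \<Longrightarrow> adj p w \<Longrightarrow> p = last P"
    and lev_C: "levelling (insert (last P) C) (last P) e"
begin

text \<open>
  Excluding \<open>t\<close> keeps clean vertices away from the end at \<open>q0\<close> of the paths through the upper levels.
\<close>
definition clean :: "'a \<Rightarrow> bool" where
  "clean a \<longleftrightarrow> a \<in> W \<and> d a = Suc h \<and> (\<forall>p\<in>insert t (set P). \<not> adj a p)"

text \<open>All parents have to be clean, because \<open>shortcut\<close> is a minimum over all of
  them and the parent that attains it must be clean.\<close>

definition clean_set :: "'a set" where
  "clean_set = {w \<in> C. \<forall>a\<in>W. d a = Suc h \<longrightarrow> adj a w \<longrightarrow> clean a}"

text \<open>The intended \<open>T\<close> is \<open>P\<close> followed by a shortest path through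
  \<open>C\<close> to \<open>w\<close>. Only the length and the bound on \<open>e\<close> are
  recorded; the latter controls which vertices of \<open>T\<close> a new vertex can be adjacent
  to.\<close>

definition reaches :: "'a \<Rightarrow> 'a list \<Rightarrow> bool" where
  "reaches w T \<longleftrightarrow> T \<noteq> [] \<and> induced_path T \<and> hd T = q0 \<and> last T = w \<and> length T = Suc m + e w \<and>
    set T \<subseteq> set P \<union> {z \<in> C. z = w \<or> e z < e w}"

text \<open>The parity of this number is the colour of \<open>w\<close>. The choice
  \<open>z = w\<close> is allowed, which gives \<open>shortcut w \<le> e w\<close> as soon as
  \<open>w\<close> has a parent.\<close>

definition shortcut :: "'a \<Rightarrow> nat" where
  "shortcut w = (LEAST n. \<exists>a\<in>W. \<exists>z\<in>C. d a = Suc h \<and> adj a w \<and> adj a z \<and> e z = n)"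

lemma q0_in_P: "q0 \<in> set P"
  using P(1,4) by (metis hd_in_set)

lemma clean_not_q0: "clean a \<Longrightarrow> a \<noteq> q0"
  using t(3) by (auto simp: clean_def)

lemma clean_not_P: "clean a \<Longrightarrow> a \<notin> set P"
  using clean_not_q0[of a] P_level[of a] by (auto simp: clean_def)

lemma clean_not_C: "clean a \<Longrightarrow> a \<notin> C"
  using C_level[of a] by (auto simp: clean_def)

lemma non_adjacent_levels:
  assumes "x \<in> W" "y \<in> W" "Suc (d y) < d x"
  shows "\<not> adj x y"
  using levelling_step[OF lev_W assms(2,1)] assms(3) adj_sym by fastforce

text \<open>Follow predecessors to \<open>z0\<close>. All vertices after the first lie in levels
  below \<open>h\<close> in number, at least two away from \<open>avoid\<close>, so only the start
  has to be assumed nonadjacent to it.\<close>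

lemma descent:
  assumes "avoid \<subseteq> {a \<in> W. d a = Suc h}"
    and "y \<in> W" "d y \<le> h" "\<forall>a\<in>avoid. \<not> adj a y"
  shows "(y, z0) \<in> (edges_in {y \<in> W. d y \<le> h \<and> (\<forall>a\<in>avoid. \<not> adj a y)})\<^sup>*"
  using assms(2-)
proof (induction "d y" arbitrary: y rule: less_induct)
  case less
  show ?case
  proof (cases "y = z0")
    case False
    then obtain z where z: "z \<in> W" "adj y z" "Suc (d z) = d y"
      using levelling_parent[OF lev_W less.prems(1)] by blast
    have "\<forall>a\<in>avoid. \<not> adj a z"
    proof
      fix a assume "a \<in> avoid"
      then show "\<not> adj a z"
        using assms(1) z less.prems by (intro non_adjacent_levels) auto
    qed
    then have "(z, z0) \<in> (edges_in {y \<in> W. d y \<le> h \<and> (\<forall>a\<in>avoid. \<not> adj a y)})\<^sup>*"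
      and "(y, z) \<in> edges_in {y \<in> W. d y \<le> h \<and> (\<forall>a\<in>avoid. \<not> adj a y)}"
      using less z by (auto simp: edges_in_def)
    then show ?thesis
      by (rule converse_rtrancl_into_rtrancl[rotated])
  qed simp
qed

text \<open>\<open>ys\<close> is the interior of an induced path from \<open>b\<close> to
  \<open>q0\<close> through the region of levels up to \<open>h\<close> that misses all neighbours
  of \<open>avoid\<close>. The region contains \<open>s\<close> and also \<open>t\<close>, as clean
  vertices are not adjacent to \<open>t\<close>; both are joined to \<open>z0\<close> inside
  it.\<close>

lemma upper_path:
  assumes b: "clean b" and s: "s \<in> W" "d s = h" "adj b s"
    and avoid: "\<And>a. a \<in> avoid \<Longrightarrow> clean a" "\<And>a. a \<in> avoid \<Longrightarrow> \<not> adj a s"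
  obtains ys where "ys \<noteq> []" "induced_path ys"
    "\<And>y. y \<in> set ys \<Longrightarrow> y \<in> W \<and> d y \<le> h \<and> (\<forall>a\<in>avoid. \<not> adj a y)"
    "\<And>y. y \<in> set ys \<Longrightarrow> adj b y \<longleftrightarrow> y = hd ys"
    "\<And>y. y \<in> set ys \<Longrightarrow> adj q0 y \<longleftrightarrow> y = last ys"
proof -
  define X where "X = {y \<in> W. d y \<le> h \<and> (\<forall>a\<in>avoid. \<not> adj a y)}"
  have avoid': "avoid \<subseteq> {a \<in> W. d a = Suc h}"
    using avoid(1) by (auto simp: clean_def)
  have st: "s \<in> X" "t \<in> X"
    using s t avoid by (auto simp: X_def clean_def)
  then have "(s, z0) \<in> (edges_in X)\<^sup>*" "(t, z0) \<in> (edges_in X)\<^sup>*"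
    unfolding X_def by (auto intro!: descent[OF avoid'])
  then have "(s, t) \<in> (edges_in X)\<^sup>*"
    by (meson rtrancl_trans sym_edges_in_rtrancl)
  then have "(s, t) \<in> (edges_in ({b, q0} \<union> X))\<^sup>*"
    using edges_in_mono[of X "{b, q0} \<union> X"] by blast
  moreover have "(b, s) \<in> edges_in ({b, q0} \<union> X)" "(t, q0) \<in> edges_in ({b, q0} \<union> X)"
    using st s(3) t(3) adj_sym by (auto simp: edges_in_def)
  ultimately have "(b, q0) \<in> (edges_in ({b, q0} \<union> X))\<^sup>*"
    by (meson converse_rtrancl_into_rtrancl rtrancl.rtrancl_into_rtrancl)
  then obtain xs where xs: "xs \<noteq> []" "induced_path xs" "hd xs = b" "last xs = q0"
    "set xs \<subseteq> {b, q0} \<union> X"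
    by (rule rtrancl_induced_path) auto
  obtain zs where zs: "xs = b # zs"
    using xs(1,3) by (cases xs) auto
  have "zs \<noteq> []"
    using xs(4) zs clean_not_q0[OF b] by auto
  then have "zs = butlast zs @ [q0]"
    using xs(4) zs by (metis append_butlast_last_id last.simps)
  then obtain ys where ys: "xs = b # ys @ [q0]"
    using zs by blast
  have path: "induced_path (ys @ [q0])" "b \<notin> set ys" "q0 \<notin> set ys"
    "\<forall>y\<in>set (ys @ [q0]). adj b y \<longleftrightarrow> y = hd (ys @ [q0])"
    using xs(2) unfolding ys by (auto simp: induced_path_snoc)
  \<comment> \<open>An empty interior would make \<open>b\<close> adjacent to \<open>q0\<close>, a
    vertex of \<open>P\<close>, although \<open>b\<close> is clean.\<close>
  have ne: "ys \<noteq> []"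
    using path(4) b q0_in_P by (auto simp: clean_def)
  show thesis
  proof (rule that[of ys])
    show "ys \<noteq> []" by fact
    show "induced_path ys"
      using path(1) by (simp add: induced_path_snoc)
    show "y \<in> W \<and> d y \<le> h \<and> (\<forall>a\<in>avoid. \<not> adj a y)" if "y \<in> set ys" for y
      using xs(5) path(2,3) that unfolding ys X_def by auto
    show "adj b y \<longleftrightarrow> y = hd ys" if "y \<in> set ys" for y
      using path(4) that ne by simp
    show "adj q0 y \<longleftrightarrow> y = last ys" if "y \<in> set ys" for y
      using path(1) that adj_commute[of q0 y] by (simp add: induced_path_snoc)
  qed
qed

text \<open>Both paths close up to holes through one and the same path in the levels up to \<open>h\<close>.\<close>
lemma parity:
  assumes b: "clean b" and s: "s \<in> W" "d s = h" "adj b s"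
    and avoid: "\<And>a. a \<in> avoid \<Longrightarrow> clean a" "\<And>a. a \<in> avoid \<Longrightarrow> \<not> adj a s"
    and paths: "\<And>T. T \<in> {T1, T2} \<Longrightarrow> induced_path T \<and> hd T = q0 \<and> last T = b \<and>
      length T \<ge> m + 3 \<and> set T \<subseteq> insert b (set P \<union> C \<union> avoid)"
  shows "even (length T1 + length T2)"
proof -
  obtain ys where ys: "ys \<noteq> []" "induced_path ys"
    "\<And>y. y \<in> set ys \<Longrightarrow> y \<in> W \<and> d y \<le> h \<and> (\<forall>a\<in>avoid. \<not> adj a y)"
    "\<And>y. y \<in> set ys \<Longrightarrow> adj b y \<longleftrightarrow> y = hd ys"
    "\<And>y. y \<in> set ys \<Longrightarrow> adj q0 y \<longleftrightarrow> y = last ys"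
    using upper_path[OF b s avoid] by blast
  have "even (length T + length ys)" if "T \<in> {T1, T2}" for T
  proof -
    note T = paths[OF that]
    have below: "x \<in> W \<and> d x \<ge> Suc h" if "x \<in> set T" for x
      using T that b q0 P_level[of x] C_level[of x] avoid(1)[of x] by (cases "x = q0") (auto simp: clean_def)
    have "induced_cycle (T @ ys)"
    proof (rule induced_cycle_append)
      show "induced_path T" "induced_path ys" "ys \<noteq> []"
        using T ys by auto
      show "2 \<le> length T" "4 \<le> length T + length ys"
        using T ys(1) by (cases ys; simp)+
      show "set T \<inter> set ys = {}"
        using below ys(3) by fastforce
      show "adj x y \<longleftrightarrow> x = last T \<and> y = hd ys \<or> x = hd T \<and> y = last ys"
        if xy: "x \<in> set T" "y \<in> set ys" for x y
      proof -
        \<comment> \<open>Only the ends \<open>b\<close> and \<open>q0\<close> of \<open>T\<close>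
          have neighbours on \<open>ys\<close>: vertices of \<open>avoid\<close> have none by the
          choice of \<open>ys\<close>, and the rest of \<open>T\<close> lies in level
          \<open>h + 2\<close>, too far from level \<open>h\<close>.\<close>
        consider "x = b" | "x = q0" | "x \<noteq> b" "x \<noteq> q0" "x \<in> avoid"
          | "x \<noteq> b" "x \<noteq> q0" "x \<in> W" "d x = Suc (Suc h)"
          using T xy P_level C_level by blast
        then show ?thesis
        proof cases
          case 4
          then have "\<not> adj x y"
            using ys(3)[OF xy(2)] by (intro non_adjacent_levels) auto
          with 4 T show ?thesis by auto
        qed (use T ys(3-5)[OF xy(2)] clean_not_q0[OF b] in auto)
      qed
    qed
    \<comment> \<open>The nonempty \<open>ys\<close> adds the one vertex missing from
      \<open>m + 3\<close> to the length from which induced cycles are even.\<close>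
    moreover have "length (T @ ys) \<ge> m + 4"
      using T ys(1) by (cases ys) auto
    ultimately show ?thesis
      using long_induced_cycle_even by fastforce
  qed
  from this[of T1] this[of T2] show ?thesis
    by auto
qed

section \<open>Paths along \<open>P\<close> and on through \<open>C\<close>\<close>

lemma e_last_P: "e (last P) = 0"
  using lev_C by (auto simp: levelling_def)

lemma e_pos: "w \<in> C \<Longrightarrow> e w > 0"
  using levelling_0[OF lev_C, of w] P_C_disjoint P(1) last_in_set[of P] by (metis IntI empty_iff gr0I insertI2)

lemma adj_P_C: "p \<in> set P \<Longrightarrow> w \<in> C \<Longrightarrow> adj p w \<Longrightarrow> e w = 1"
  using P_C[of p w] levelling_step[OF lev_C, of "last P" w] e_last_P e_pos[of w] by fastforce

lemma adj_C: "w \<in> C \<Longrightarrow> z \<in> C \<Longrightarrow> adj w z \<Longrightarrow> e z \<le> Suc (e w)"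
  using levelling_step[OF lev_C] by blast

lemma C_parent:
  assumes "w \<in> C" "e w \<noteq> 1"
  obtains z where "z \<in> C" "adj w z" "e w = Suc (e z)"
proof -
  have "w \<noteq> last P"
    using e_pos[OF assms(1)] e_last_P by auto
  then obtain z where z: "z \<in> insert (last P) C" "adj w z" "Suc (e z) = e w"
    using levelling_parent[OF lev_C] assms(1) by blast
  then have "z \<noteq> last P"
    using e_last_P assms(2) by auto
  with z that show thesis
    by auto
qed

text \<open>Here \<open>e w\<close> is at least 2, so \<open>w\<close> has no neighbour on
  \<open>P\<close>; the vertices of \<open>T\<close> in \<open>C\<close> other than \<open>z\<close>
  have \<open>e\<close> at least two below \<open>e w\<close>.\<close>

lemma reaches_step:
  assumes T: "reaches z T" and z: "z \<in> C" and w: "w \<in> C" "adj w z" "e w = Suc (e z)"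
  shows "reaches w (T @ [w])"
proof -
  have "adj x w \<longleftrightarrow> x = last T" if x: "x \<in> set T" for x
  proof
    assume xw: "adj x w"
    have "x \<notin> set P"
      using adj_P_C[OF _ w(1) xw] e_pos[OF z] w(3) by auto
    then have "x \<in> C" "x = z \<or> e x < e z"
      using T x by (auto simp: reaches_def)
    then show "x = last T"
      using adj_C[OF _ w(1) xw] w(3) T by (auto simp: reaches_def)
  next
    assume "x = last T"
    then show "adj x w"
      using T w(2) adj_sym by (auto simp: reaches_def)
  qed
  moreover have "w \<notin> set T"
    using T w P_C_disjoint by (auto simp: reaches_def)
  ultimately show ?thesis
    using T w z by (auto simp: reaches_def induced_path_snoc)
qed

lemma reaches_exists: "w \<in> C \<Longrightarrow> \<exists>T. reaches w T"
proof (induction "e w" arbitrary: w)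
  case 0
  then show ?case using e_pos by force
next
  case (Suc n)
  show ?case
  proof (cases "e w = 1")
    case True
    then have "w \<noteq> last P"
      using e_last_P by auto
    then obtain z where z: "z \<in> insert (last P) C" "adj w z" "Suc (e z) = e w"
      using levelling_parent[OF lev_C, of w] Suc.prems by blast
    then have "z = last P"
      using levelling_0[OF lev_C z(1)] True by simp
    then have "adj x w \<longleftrightarrow> x = last P" if "x \<in> set P" for x
      using P_C[OF that Suc.prems] z(2) adj_sym by blast
    moreover have "w \<notin> set P"
      using Suc.prems P_C_disjoint by blast
    ultimately have "reaches w (P @ [w])"
      using P Suc.prems True by (auto simp: reaches_def induced_path_snoc)
    then show ?thesis ..
  next
    case False
    then obtain z where z: "z \<in> C" "adj w z" "e w = Suc (e z)"
      using C_parent[OF Suc.prems] by blast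
    then obtain T where "reaches z T"
      using Suc.hyps by fastforce
    then have "reaches w (T @ [w])"
      using z Suc.prems by (intro reaches_step)
    then show ?thesis ..
  qed
qed

lemma upper_parent:
  assumes "clean a"
  obtains s where "s \<in> W" "d s = h" "adj a s"
proof -
  have a: "a \<in> W" "d a = Suc h"
    using assms by (auto simp: clean_def)
  then have "\<exists>s\<in>W. adj a s \<and> d s = h"
    using lev_W unfolding levelling_def by blast
  then show thesis
    using that by blast
qed

section \<open>Shortcuts and the 2-colouring of the clean set\<close>

lemma shortcut_le:
  "a \<in> W \<Longrightarrow> d a = Suc h \<Longrightarrow> adj a w \<Longrightarrow> z \<in> C \<Longrightarrow> adj a z \<Longrightarrow> shortcut w \<le> e z"
  unfolding shortcut_def by (rule Least_le) blast

lemma shortcut_attained: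
  assumes "w \<in> clean_set"
  obtains a x where "clean a" "adj a w" "x \<in> C" "adj a x" "e x = shortcut w"
    "\<And>z. z \<in> C \<Longrightarrow> adj a z \<Longrightarrow> shortcut w \<le> e z"
proof -
  have w: "w \<in> C" "\<And>a. a \<in> W \<Longrightarrow> d a = Suc h \<Longrightarrow> adj a w \<Longrightarrow> clean a"
    using assms by (auto simp: clean_set_def)
  have "d w = Suc (Suc h)" "w \<in> W"
    using C_level[OF w(1)] by auto
  then have "\<exists>a\<in>W. d a = Suc h \<and> adj a w"
    using lev_W adj_commute unfolding levelling_def by metis
  then have "\<exists>n. \<exists>a\<in>W. \<exists>z\<in>C. d a = Suc h \<and> adj a w \<and> adj a z \<and> e z = n"
    using w(1) by blast
  then have "\<exists>a\<in>W. \<exists>z\<in>C. d a = Suc h \<and> adj a w \<and> adj a z \<and> e z = shortcut w"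
    unfolding shortcut_def by (rule LeastI_ex)
  then show thesis
    using w(2) that shortcut_le by blast
qed

lemma clean_set_D:
  assumes "w \<in> clean_set"
  shows "w \<in> C" and "shortcut w \<le> e w"
proof -
  show "w \<in> C"
    using assms by (simp add: clean_set_def)
  then show "shortcut w \<le> e w"
    using shortcut_attained[OF assms] by metis
qed

text \<open>Being clean, \<open>a\<close> has no neighbour on \<open>P\<close>, and the vertices of
  \<open>T\<close> in \<open>C\<close> other than \<open>x\<close> are nearer to \<open>P\<close>
  than any neighbour of \<open>a\<close>.\<close>

lemma reaches_snoc:
  assumes T: "reaches x T" and a: "clean a" "adj a x"
    and first: "\<And>z. z \<in> C \<Longrightarrow> adj a z \<Longrightarrow> e x \<le> e z"
  shows "induced_path (T @ [a])"
proof -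
  have "adj z a \<longleftrightarrow> z = last T" if z: "z \<in> set T" for z
  proof
    assume "adj z a"
    then have "adj a z" by (rule adj_sym)
    then have "z \<notin> set P"
      using a(1) by (auto simp: clean_def)
    then show "z = last T"
      using T z first[OF _ \<open>adj a z\<close>] by (auto simp: reaches_def)
  next
    assume "z = last T"
    then show "adj z a"
      using T a(2) adj_sym by (auto simp: reaches_def)
  qed
  moreover have "a \<notin> set T"
    using T clean_not_C[OF a(1)] clean_not_P[OF a(1)] by (auto simp: reaches_def)
  ultimately show ?thesis
    using T by (auto simp: reaches_def induced_path_snoc)
qed

text \<open>Otherwise the parent \<open>a\<close> attaining the shortcut at \<open>x\<close> ends
  two induced paths whose lengths differ by one: one through \<open>x\<close>, the other through a
  predecessor \<open>w'\<close> of \<open>w\<close>, on the same level as \<open>x\<close>, and then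
  \<open>w\<close>.\<close>

lemma shortcut_not_pred:
  assumes w: "w \<in> clean_set"
  shows "e w \<noteq> Suc (shortcut w)"
proof
  assume ew: "e w = Suc (shortcut w)"
  obtain a x where ax: "clean a" "adj a w" "x \<in> C" "adj a x" "e x = shortcut w"
    "\<And>z. z \<in> C \<Longrightarrow> adj a z \<Longrightarrow> shortcut w \<le> e z"
    using shortcut_attained[OF w] by blast
  obtain w' where w': "w' \<in> C" "adj w w'" "e w = Suc (e w')"
    using C_parent[OF clean_set_D(1)[OF w]] e_pos[OF ax(3)] ax(5) ew by auto
  obtain T1 T2 where T: "reaches x T1" "reaches w' T2"
    using reaches_exists ax(3) w'(1) by blast
  have p1: "induced_path (T1 @ [a])"
    using reaches_snoc[OF T(1) ax(1,4)] ax(5,6) by simp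
  have T2w: "reaches w (T2 @ [w])"
    using reaches_step[OF T(2) w'(1) clean_set_D(1)[OF w] w'(2,3)] .
  have "adj z a \<longleftrightarrow> z = w" if z: "z \<in> set (T2 @ [w])" for z
  proof
    assume "adj z a"
    then have "adj a z" by (rule adj_sym)
    \<comment> \<open>Adjacency of \<open>a\<close> to \<open>w'\<close> would complete a triangle
      with \<open>w\<close>; all earlier vertices of \<open>T2\<close> in \<open>C\<close> are
      excluded by minimality of the shortcut.\<close>
    then have "z \<notin> set P" "z \<noteq> w'"
      using ax(1,2) w'(2) triangle[of a w w'] adj_sym by (auto simp: clean_def)
    then show "z = w"
      using T(2) z ax(6)[OF _ \<open>adj a z\<close>] w'(3) ew by (auto simp: reaches_def)
  next
    assume "z = w"
    then show "adj z a"
      using ax(2) adj_sym by simp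
  qed
  moreover have "a \<notin> set (T2 @ [w])"
    using T2w clean_not_C[OF ax(1)] clean_not_P[OF ax(1)] by (auto simp: reaches_def)
  ultimately have p2: "induced_path ((T2 @ [w]) @ [a])"
    using T2w by (subst induced_path_snoc) (simp add: reaches_def)
  obtain s where s: "s \<in> W" "d s = h" "adj a s"
    using upper_parent[OF ax(1)] .
  have "even (length (T1 @ [a]) + length ((T2 @ [w]) @ [a]))"
  proof (rule parity[OF ax(1) s, where avoid = "{}"])
    show "induced_path T \<and> hd T = q0 \<and> last T = a \<and> m + 3 \<le> length T \<and>
        set T \<subseteq> insert a (set P \<union> C \<union> {})" if "T \<in> {T1 @ [a], (T2 @ [w]) @ [a]}" for T
      using that p1 p2 T(1) T2w e_pos[OF ax(3)] e_pos[OF clean_set_D(1)[OF w]]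
      by (auto simp: reaches_def simp del: append_assoc)
  qed auto
  moreover have "length (T1 @ [a]) + length ((T2 @ [w]) @ [a]) = Suc (2 * (Suc (Suc m) + shortcut w))"
    using T(1) T2w ax(5) ew by (simp add: reaches_def)
  ultimately have "even (Suc (2 * (Suc (Suc m) + shortcut w)))"
    by (simp only:)
  then show False
    by simp
qed

text \<open>A parent \<open>a\<close> of \<open>u\<close> with no neighbour in \<open>C\<close>
  nearer than \<open>u\<close> ends two induced paths of different parity: one arrives by a shortest
  route to \<open>u\<close>, the other goes to \<open>v\<close> first and is longer by one.\<close>

lemma shortcut_not_same_level:
  assumes u: "u \<in> clean_set" and v: "v \<in> C" and uv: "adj u v"
    and eu: "e u = shortcut u" and ev: "e v = shortcut u"
  shows False
proof -
  note uC = clean_set_D(1)[OF u]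
  obtain a where a: "clean a" "adj a u" "\<And>z. z \<in> C \<Longrightarrow> adj a z \<Longrightarrow> shortcut u \<le> e z"
    using shortcut_attained[OF u] by metis
  show False
  proof (cases "e v = 1")
    case True
    \<comment> \<open>On level 1 there is no predecessor in \<open>C\<close> to route through;
      instead \<open>u\<close>, \<open>v\<close> and \<open>last P\<close> form a triangle.\<close>
    have "adj x (last P)" if x: "x \<in> C" "e x = 1" for x
    proof -
      have "x \<noteq> last P"
        using x e_last_P by auto
      then obtain z where z: "z \<in> insert (last P) C" "adj x z" "Suc (e z) = e x"
        using levelling_parent[OF lev_C, of x] x by blast
      then show ?thesis
        using levelling_0[OF lev_C z(1)] x by simp
    qed
    then have "adj u (last P)" "adj v (last P)"
      using True uC v eu ev by auto
    then show False
      using uv triangle adj_sym by blast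
  next
    case False
    then obtain v' where v': "v' \<in> C" "adj v v'" "e v = Suc (e v')"
      using C_parent[OF v] by blast
    obtain T1 T2 where T: "reaches u T1" "reaches v' T2"
      using reaches_exists uC v'(1) by blast
    have p1: "induced_path (T1 @ [a])"
      using reaches_snoc[OF T(1) a(1,2)] a(3) eu by simp
    have T2v: "reaches v (T2 @ [v])"
      using reaches_step[OF T(2) v'(1) v v'(2,3)] .
    have "adj z u \<longleftrightarrow> z = v" if z: "z \<in> set (T2 @ [v])" for z
    proof
      assume zu: "adj z u"
      then have "z \<notin> set P"
        using adj_P_C[OF _ uC zu] False eu ev by auto
      moreover have "z \<noteq> v'"
        using zu uv v'(2) triangle by blast
      ultimately show "z = v"
        using T(2) z adj_C[OF _ uC zu] v'(3) eu ev by (auto simp: reaches_def)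
    next
      assume "z = v"
      then show "adj z u"
        using uv adj_sym by simp
    qed
    moreover have "u \<notin> set (T2 @ [v])"
      using T(2) P_C_disjoint uC eu ev v'(3) uv adj_irrefl by (auto simp: reaches_def)
    ultimately have p2: "induced_path ((T2 @ [v]) @ [u])"
      using T2v by (subst induced_path_snoc) (simp add: reaches_def)
    have "adj z a \<longleftrightarrow> z = u" if z: "z \<in> set ((T2 @ [v]) @ [u])" for z
    proof
      assume "adj z a"
      then have "adj a z" by (rule adj_sym)
      then have "z \<notin> set P" "z \<noteq> v"
        using a(1,2) uv triangle[of a u v] adj_sym by (auto simp: clean_def)
      then show "z = u"
        using T(2) z a(3)[OF _ \<open>adj a z\<close>] v'(3) ev by (auto simp: reaches_def)
    next
      assume "z = u"
      then show "adj z a"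
        using a(2) adj_sym by simp
    qed
    moreover have "a \<notin> set ((T2 @ [v]) @ [u])"
      using T2v clean_not_C[OF a(1)] clean_not_P[OF a(1)] uC by (auto simp: reaches_def)
    ultimately have p3: "induced_path (((T2 @ [v]) @ [u]) @ [a])"
      using p2 by (subst induced_path_snoc) simp
    obtain s where s: "s \<in> W" "d s = h" "adj a s"
      using upper_parent[OF a(1)] .
    have "even (length (T1 @ [a]) + length (((T2 @ [v]) @ [u]) @ [a]))"
    proof (rule parity[OF a(1) s, where avoid = "{}"])
      show "induced_path T \<and> hd T = q0 \<and> last T = a \<and> m + 3 \<le> length T \<and>
          set T \<subseteq> insert a (set P \<union> C \<union> {})" if "T \<in> {T1 @ [a], ((T2 @ [v]) @ [u]) @ [a]}" for T
        using that p1 p3 T(1) T2v e_pos[OF uC] uC e_pos[OF v]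
        by (auto simp: reaches_def simp del: append_assoc)
    qed auto
    moreover have "length (T1 @ [a]) + length (((T2 @ [v]) @ [u]) @ [a]) =
        Suc (2 * (Suc (Suc m) + shortcut u))"
      using T(1) T2v eu ev by (simp add: reaches_def)
    ultimately have "even (Suc (2 * (Suc (Suc m) + shortcut u)))"
      by (simp only:)
    then show False
      by simp
  qed
qed

text \<open>Let \<open>a\<close> and \<open>b\<close> be parents attaining the two shortcuts. One
  path reaches \<open>b\<close> directly through \<open>y\<close>, the other goes through
  \<open>x\<close> and \<open>a\<close> and then on to \<open>b\<close>. With equal shortcut
  parities, the extra vertex \<open>a\<close> makes the lengths differ in parity.\<close>

lemma shortcut_not_same_parity:
  assumes u: "u \<in> clean_set" and v: "v \<in> clean_set" and uv: "adj u v"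
    and le: "shortcut u \<le> shortcut v" and ev: "even (shortcut u + shortcut v)"
    and high: "shortcut u + 2 \<le> e u" "shortcut u + 2 \<le> e v"
  shows False
proof -
  note uC = clean_set_D(1)[OF u] and vC = clean_set_D(1)[OF v]
  obtain a x where a: "clean a" "adj a u" "x \<in> C" "adj a x" "e x = shortcut u"
    "\<And>z. z \<in> C \<Longrightarrow> adj a z \<Longrightarrow> shortcut u \<le> e z"
    using shortcut_attained[OF u] by metis
  obtain b y where b: "clean b" "adj b v" "y \<in> C" "adj b y" "e y = shortcut v"
    "\<And>z. z \<in> C \<Longrightarrow> adj b z \<Longrightarrow> shortcut v \<le> e z"
    using shortcut_attained[OF v] by metis
  obtain s where s: "s \<in> W" "d s = h" "adj b s"
    using upper_parent[OF b(1)] .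
  have sa: "\<not> adj a s"
    \<comment> \<open>so the upper path of \<open>b\<close> can leave through \<open>s\<close> even if \<open>a\<close> is used below it\<close>
    using pentagon[of a u v b s] a(2) b(2) s(3) uv adj_sym by blast
  have ab: "a \<noteq> b"
    using s(3) sa by auto
  obtain T1 T2 where T: "reaches y T1" "reaches x T2"
    using reaches_exists a(3) b(3) by blast
  have p1: "induced_path (T1 @ [b])"
    using reaches_snoc[OF T(1) b(1,4)] b(5,6) by simp
  have p2: "induced_path (T2 @ [a])"
    using reaches_snoc[OF T(2) a(1,4)] a(5,6) by simp
  have b_new: "b \<notin> set T2"
    using T(2) clean_not_C[OF b(1)] clean_not_P[OF b(1)] by (auto simp: reaches_def)
  \<comment> \<open>By \<open>le\<close>, vertices of \<open>T2\<close> in \<open>C\<close> other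
    than \<open>x\<close> are nearer to \<open>P\<close> than any neighbour of
    \<open>b\<close>.\<close>
  have b_far: "z = x" if z: "z \<in> set T2" "adj z b" for z
  proof -
    have "adj b z"
      using z(2) by (rule adj_sym)
    moreover from this have "z \<notin> set P"
      using b(1) by (auto simp: clean_def)
    ultimately show ?thesis
      using T(2) z(1) b(6)[of z] le a(5) by (auto simp: reaches_def)
  qed
  \<comment> \<open>The connection \<open>ws\<close> from \<open>a\<close> to \<open>b\<close> is
    empty if they are adjacent and \<open>[u, v]\<close> otherwise; its even length does not affect
    parity.\<close>
  have "\<exists>ws. induced_path ((T2 @ [a]) @ ws @ [b]) \<and> set ws \<subseteq> C \<and> even (length ws)"
  proof (cases "adj a b")
    case True
    then have "\<not> adj x b"
      using triangle a(4) adj_sym by blast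
    then have "adj z b \<longleftrightarrow> z = a" if "z \<in> set (T2 @ [a])" for z
      using that b_far True by auto
    then have "induced_path ((T2 @ [a]) @ [b])"
      using p2 b_new ab by (subst induced_path_snoc) auto
    then show ?thesis
      by (intro exI[of _ "[]"]) simp
  next
    case False
    have xb: "\<not> adj x b"
      using pentagon[of x a u v b] a(2,4) b(2) uv adj_sym by blast
    have low: "z \<in> set P \<or> z \<in> C \<and> e z \<le> shortcut u" if "z \<in> set T2" for z
      using T(2) that a(5) by (auto simp: reaches_def)
    \<comment> \<open>The assumption \<open>high\<close> enters here: \<open>u\<close> and
      \<open>v\<close> are at least two levels beyond everything on \<open>T2\<close>.\<close>
    have far: "w \<notin> set T2 \<and> \<not> adj z w"
      if w: "w \<in> C" "shortcut u + 2 \<le> e w" and z: "z \<in> set T2" for w z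
    proof
      show "w \<notin> set T2"
        using low[of w] w P_C_disjoint by auto
      show "\<not> adj z w"
        using low[OF z] adj_P_C[of z w] adj_C[of z w] w by auto
    qed
    have T2: "T2 \<noteq> []"
      using T(2) by (simp add: reaches_def)
    have "induced_path ((T2 @ [a]) @ [u])"
      using p2 far[OF uC high(1)] a(1,2) uC clean_not_C T2 last_in_set[OF T2]
      by (subst induced_path_snoc) auto
    then have "induced_path (((T2 @ [a]) @ [u]) @ [v])"
      using far[OF vC high(2)] a(1,2) uv vC clean_not_C T2 last_in_set[OF T2] triangle[of a u v]
        adj_sym adj_irrefl
      by (subst induced_path_snoc) auto
    moreover have "\<not> adj u b"
      using triangle[of u v b] uv b(2) adj_sym by blast
    ultimately have "induced_path ((((T2 @ [a]) @ [u]) @ [v]) @ [b])"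
      using False xb b_far b_new ab b(1,2) uC vC clean_not_C adj_sym[OF b(2)]
      by (subst induced_path_snoc) auto
    then show ?thesis
      using uC vC by (intro exI[of _ "[u, v]"]) simp
  qed
  then obtain ws where ws: "induced_path ((T2 @ [a]) @ ws @ [b])" "set ws \<subseteq> C" "even (length ws)"
    by blast
  have "even (length (T1 @ [b]) + length ((T2 @ [a]) @ ws @ [b]))"
  proof (rule parity[OF b(1) s, where avoid = "{a}"])
    show "induced_path T \<and> hd T = q0 \<and> last T = b \<and> m + 3 \<le> length T \<and>
        set T \<subseteq> insert b (set P \<union> C \<union> {a})" if "T \<in> {T1 @ [b], (T2 @ [a]) @ ws @ [b]}" for T
      using that p1 ws(1,2) T e_pos[OF a(3)] e_pos[OF b(3)] a(3) b(3)
      by (auto simp: reaches_def)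
  qed (use a(1) sa in auto)
  moreover have "length (T1 @ [b]) + length ((T2 @ [a]) @ ws @ [b]) =
      Suc (2 * (Suc (Suc m))) + (shortcut u + shortcut v) + length ws"
    using T a(5) b(5) by (simp add: reaches_def)
  ultimately have "even (Suc (2 * (Suc (Suc m))) + (shortcut u + shortcut v) + length ws)"
    by (simp only:)
  then show False
    using ev ws(3) by simp
qed

text \<open>Suppose the parities agree and \<open>shortcut u \<le> shortcut v\<close>. Since
  \<open>e u\<close> and \<open>e v\<close> differ by at most one and neither exceeds its shortcut
  by exactly one, either both are at least \<open>shortcut u + 2\<close> or both equal
  \<open>shortcut u\<close>. Each case has been excluded.\<close>

lemma clean_edge_parity:
  assumes "u \<in> clean_set" "v \<in> clean_set" "adj u v"
  shows "odd (shortcut u + shortcut v)"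
proof -
  have "odd (shortcut u + shortcut v)"
    if u: "u \<in> clean_set" and v: "v \<in> clean_set" and uv: "adj u v"
      and le: "shortcut u \<le> shortcut v" for u v
  proof
    assume ev: "even (shortcut u + shortcut v)"
    have "shortcut u \<le> e u" "shortcut v \<le> e v"
      using clean_set_D u v by auto
    moreover have "e u \<noteq> Suc (shortcut u)" "e v \<noteq> Suc (shortcut v)"
      using shortcut_not_pred u v by auto
    moreover have "e v \<le> Suc (e u)" "e u \<le> Suc (e v)"
      using adj_C clean_set_D(1) u v uv adj_sym by blast+
    moreover have "shortcut v \<noteq> Suc (shortcut u)"
      using ev by auto
    moreover have "\<not> (shortcut u + 2 \<le> e u \<and> shortcut u + 2 \<le> e v)"
      using shortcut_not_same_parity[OF u v uv le ev] by blast
    moreover have "\<not> (e u = shortcut u \<and> e v = shortcut u)"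
      using shortcut_not_same_level[OF u clean_set_D(1)[OF v] uv] by blast
    ultimately show False
      using le by linarith
  qed
  then show ?thesis
    using assms adj_sym by (metis add.commute nat_le_linear)
qed

text \<open>The count is one stable set for \<open>t\<close>, \<open>m + 1\<close> for the vertices
  of \<open>P\<close> and two parity classes.\<close>

lemma colourable_C: "colourable C (m + 4)"
proof -
  define S where "S i = {w \<in> clean_set. shortcut w mod 2 = i}" for i :: nat
  define N where "N p = {w. \<exists>a. adj w a \<and> adj a p}" for p
  let ?Ts = "map N (t # P) @ [S 0, S 1]"
  have "stable (S i)" for i
    unfolding stable_def
  proof (intro ballI notI)
    fix u v assume "u \<in> S i" "v \<in> S i" "adj u v"
    then have "odd (shortcut u + shortcut v)" "shortcut u mod 2 = shortcut v mod 2"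
      using clean_edge_parity by (auto simp: S_def)
    then show False
      by presburger
  qed
  moreover have "stable (N p)" for p
    unfolding N_def by (rule stable_second_neighbours)
  ultimately have "colourable (\<Union>(set ?Ts)) (length ?Ts)"
    by (intro colourable_stable_cover) auto
  moreover have "C \<subseteq> \<Union>(set ?Ts)"
  proof
    fix w assume w: "w \<in> C"
    show "w \<in> \<Union>(set ?Ts)"
    proof (cases "w \<in> clean_set")
      case True
      then have "w \<in> S 0 \<or> w \<in> S 1"
        by (auto simp: S_def)
      then show ?thesis by auto
    next
      case False
      then obtain a p where "adj a w" "p \<in> insert t (set P)" "adj a p"
        using w by (auto simp: clean_set_def clean_def)
      then have "w \<in> N p"
        using adj_sym by (auto simp: N_def)
      then show ?thesis
        using \<open>p \<in> insert t (set P)\<close> by auto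
    qed
  qed
  ultimately show ?thesis
    using P(3) by (auto elim: colourable_mono)
qed

end

section \<open>Growing the path, and the linear bound\<close>

context odd_hole_bounded begin

text \<open>Each new vertex of the path costs one colour, as its neighbourhood is stable.\<close>
lemma path_growth:
  assumes "q \<notin> C0" "w0 \<in> C0" "adj q w0"
    and "\<And>x y. x \<in> C0 \<Longrightarrow> y \<in> C0 \<Longrightarrow> (x, y) \<in> (edges_in C0)\<^sup>*"
    and "\<not> colourable C0 (n + k)"
  shows "\<exists>P C. P \<noteq> [] \<and> induced_path P \<and> length P = Suc k \<and> hd P = q \<and> set P \<subseteq> insert q C0 \<and>
    C \<subseteq> C0 \<and> C \<inter> set P = {} \<and> (\<forall>p\<in>set P. \<forall>w\<in>C. adj p w \<longrightarrow> p = last P) \<and>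
    (\<exists>w\<in>C. adj (last P) w) \<and> (\<forall>x\<in>C. \<forall>y\<in>C. (x, y) \<in> (edges_in C)\<^sup>*) \<and> \<not> colourable C n"
  using assms(5)
proof (induction k arbitrary: n)
  case 0
  then show ?case
    using assms by (intro exI[of _ "[q]"] exI[of _ C0]) auto
next
  case (Suc k)
  \<comment> \<open>The induction hypothesis is used with \<open>Suc n\<close>: the additional
    colour pays for the neighbours of \<open>last P\<close> that are removed next.\<close>
  then have "\<not> colourable C0 (Suc n + k)"
    by simp
  from Suc.IH[OF this] obtain P C where P: "P \<noteq> []" "induced_path P" "length P = Suc k" "hd P = q"
    "set P \<subseteq> insert q C0" and C: "C \<subseteq> C0" "C \<inter> set P = {}"
    and PC: "\<forall>p\<in>set P. \<forall>w\<in>C. adj p w \<longrightarrow> p = last P"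
    and w: "\<exists>w\<in>C. adj (last P) w"
    and conn: "\<forall>x\<in>C. \<forall>y\<in>C. (x, y) \<in> (edges_in C)\<^sup>*"
    and uncol: "\<not> colourable C (Suc n)"
    by (elim exE conjE) (rule that)
  define S where "S = {z \<in> C. \<not> adj (last P) z}"
  have "\<not> colourable S n"
  proof
    assume "colourable S n"
    then have "colourable (S \<union> {z. adj (last P) z}) (n + 1)"
      using colourable_Un stable_colourable[OF stable_neighbours] by blast
    then show False
      using uncol colourable_mono[of _ _ C "Suc n"] by (auto simp: S_def)
  qed
  then obtain x where x: "x \<in> S" "\<not> colourable (component S x) n"
    by (rule uncolourable_component)
  let ?K = "component S x"
  have K: "?K \<subseteq> S"
    by (rule component_subset[OF x(1)])
  obtain w where w: "w \<in> C" "adj (last P) w"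
    using w by blast
  have "x \<in> C"
    using x(1) by (simp add: S_def)
  then have "(w, x) \<in> (edges_in C)\<^sup>*"
    using conn w(1) by blast
  moreover have "w \<notin> ?K"
    using K w(2) by (auto simp: S_def)
  ultimately obtain y z where yz: "y \<in> C" "y \<notin> ?K" "z \<in> ?K" "adj y z"
    using crossing_edge component_refl by blast
  \<comment> \<open>Otherwise \<open>y\<close> would belong to \<open>S\<close> and, being adjacent
    to \<open>z\<close>, to the component \<open>?K\<close>.\<close>
  have y: "adj (last P) y"
    using component_closed[OF x(1) yz(3)] yz adj_sym by (auto simp: S_def)
  have K_conn: "(u, v) \<in> (edges_in ?K)\<^sup>*" if "u \<in> ?K" "v \<in> ?K" for u v
    using component_connected[OF x(1)] that sym_edges_in_rtrancl by (meson rtrancl_trans)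
  show ?case
  proof (intro exI conjI)
    show "P @ [y] \<noteq> []" "length (P @ [y]) = Suc (Suc k)" "hd (P @ [y]) = q"
      using P by auto
    show "induced_path (P @ [y])"
      using P(2) y yz(1) PC C(2) by (auto simp: induced_path_snoc)
    show "set (P @ [y]) \<subseteq> insert q C0"
      using P(5) yz(1) C(1) by auto
    show "?K \<subseteq> C0" "?K \<inter> set (P @ [y]) = {}"
      using K C yz(2) by (auto simp: S_def)
    show "\<forall>p\<in>set (P @ [y]). \<forall>w\<in>?K. adj p w \<longrightarrow> p = last (P @ [y])"
    proof (intro ballI impI)
      fix p w assume p: "p \<in> set (P @ [y])" and "w \<in> ?K" "adj p w"
      then have "w \<in> C" "\<not> adj (last P) w"
        using K by (auto simp: S_def)
      then show "p = last (P @ [y])"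
        using PC p \<open>adj p w\<close> by auto
    qed
    show "\<exists>w\<in>?K. adj (last (P @ [y])) w"
      using yz(3,4) by auto
    show "\<forall>u\<in>?K. \<forall>v\<in>?K. (u, v) \<in> (edges_in ?K)\<^sup>*"
      using K_conn by blast
    show "\<not> colourable ?K n"
      by (rule x(2))
  qed
qed

text \<open>Passing to one level halves \<open>4 * m + 8\<close>; of the remaining
  \<open>2 * m + 4\<close> colours, \<open>m\<close> are spent on growing the path, and
  \<open>m + 4\<close> are left to contradict \<open>colourable_C\<close>.\<close>

theorem colourable_linear: "colourable V (4 * m + 8)"
proof (rule ccontr)
  assume "\<not> colourable V (4 * m + 8)"
  then obtain z0 where z0: "z0 \<in> V" "\<not> colourable (component V z0) (4 * m + 8)"
    by (rule uncolourable_component)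
  define W where "W = component V z0"
  obtain d where d: "levelling W z0 d"
    unfolding W_def using levelling_exists[OF component_refl component_connected[OF z0(1)]] .
  have "\<exists>k. \<not> colourable {y \<in> W. d y = k} (2 * m + 4)"
    using levels_colourable[OF d, of "2 * m + 4"] z0(2) by (auto simp: W_def)
  then obtain k where k: "\<not> colourable {y \<in> W. d y = k} (2 * m + 4)" ..
  \<comment> \<open>This rules out level 0, a single vertex, and level 1, a neighbourhood, so there
    are two levels above for \<open>q0\<close> and \<open>t\<close>.\<close>
  have not_stable: "\<not> stable {y \<in> W. d y = k}"
    using stable_colourable colourable_mono[OF _ order_refl, of _ 1 "2 * m + 4"] k by fastforce
  have "k \<noteq> 0"
  proof
    assume "k = 0"
    then have "{y \<in> W. d y = k} \<subseteq> {z0}"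
      using levelling_0[OF d] by auto
    then show False
      using not_stable adj_irrefl by (auto simp: stable_def)
  qed
  moreover have "k \<noteq> 1"
  proof
    assume "k = 1"
    have "adj z0 y" if "y \<in> W" "d y = 1" for y
      using d that adj_sym unfolding levelling_def by (metis One_nat_def)
    then show False
      using not_stable stable_neighbours[of z0] \<open>k = 1\<close> by (auto simp: stable_def)
  qed
  ultimately obtain h where h: "k = Suc (Suc h)"
    by (metis One_nat_def not0_implies_Suc)
  obtain w0 where w0: "w0 \<in> {y \<in> W. d y = k}"
    "\<not> colourable (component {y \<in> W. d y = k} w0) (2 * m + 4)"
    using k by (rule uncolourable_component)
  define C0 where "C0 = component {y \<in> W. d y = k} w0"
  have C0: "C0 \<subseteq> {y \<in> W. d y = k}" "w0 \<in> C0"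
    unfolding C0_def using component_subset[OF w0(1)] component_refl by auto
  obtain q0 where q0: "q0 \<in> W" "d q0 = Suc h" "adj w0 q0"
    using d w0(1) h unfolding levelling_def by blast
  obtain t where t: "t \<in> W" "d t = h" "adj q0 t"
    using d q0 unfolding levelling_def by blast
  have "(x, y) \<in> (edges_in C0)\<^sup>*" if "x \<in> C0" "y \<in> C0" for x y
    using component_connected[OF w0(1)] that sym_edges_in_rtrancl unfolding C0_def
    by (meson rtrancl_trans)
  moreover have "q0 \<notin> C0"
    using C0(1) q0(2) h by auto
  moreover have "\<not> colourable C0 ((m + 4) + m)"
  proof -
    have "(m + 4) + m = 2 * m + 4"
      by simp
    then show ?thesis
      using w0(2) unfolding C0_def by metis
  qed
  ultimately have "\<exists>P C. P \<noteq> [] \<and> induced_path P \<and> length P = Suc m \<and> hd P = q0 \<and>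
    set P \<subseteq> insert q0 C0 \<and> C \<subseteq> C0 \<and> C \<inter> set P = {} \<and>
    (\<forall>p\<in>set P. \<forall>w\<in>C. adj p w \<longrightarrow> p = last P) \<and> (\<exists>w\<in>C. adj (last P) w) \<and>
    (\<forall>x\<in>C. \<forall>y\<in>C. (x, y) \<in> (edges_in C)\<^sup>*) \<and> \<not> colourable C (m + 4)"
    by (intro path_growth[OF _ C0(2) adj_sym[OF q0(3)]])
  then obtain P C where P: "P \<noteq> []" "induced_path P" "length P = Suc m" "hd P = q0"
    "set P \<subseteq> insert q0 C0" and C: "C \<subseteq> C0" "C \<inter> set P = {}"
    and PC: "\<forall>p\<in>set P. \<forall>w\<in>C. adj p w \<longrightarrow> p = last P"
    and w: "\<exists>w\<in>C. adj (last P) w"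
    and conn: "\<forall>x\<in>C. \<forall>y\<in>C. (x, y) \<in> (edges_in C)\<^sup>*"
    and uncol: "\<not> colourable C (m + 4)"
    by (elim exE conjE) (rule that)
  obtain w where w: "w \<in> C" "adj (last P) w"
    using w by blast
  have "(last P, y) \<in> (edges_in (insert (last P) C))\<^sup>*" if "y \<in> insert (last P) C" for y
  proof (cases "y = last P")
    case False
    then have "(w, y) \<in> (edges_in C)\<^sup>*"
      using conn w(1) that by blast
    then have "(w, y) \<in> (edges_in (insert (last P) C))\<^sup>*"
      using edges_in_mono[of C "insert (last P) C"] by blast
    moreover have "(last P, w) \<in> edges_in (insert (last P) C)"
      using w by (auto simp: edges_in_def)
    ultimately show ?thesis
      by (rule converse_rtrancl_into_rtrancl[rotated])
  qed simp
  then obtain e where e: "levelling (insert (last P) C) (last P) e"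
    using levelling_exists[of "last P" "insert (last P) C"] by blast
  interpret path_into_level adj m W z0 d h q0 t P C e
  proof
    show "w \<in> W \<and> d w = Suc (Suc h)" if "w \<in> C" for w
      using that C(1) C0(1) h by auto
    show "p \<in> W \<and> d p = Suc (Suc h)" if "p \<in> set P" "p \<noteq> q0" for p
      using that P(5) C0(1) h by auto
    show "p = last P" if "p \<in> set P" "w \<in> C" "adj p w" for p w
      using that PC by blast
  qed fact+
  show False
    using colourable_C uncol by blast
qed

end

section \<open>Translation between digraphs and adjacency relations\<close>

lemma (in graph) adjacency_arcs_ends: "adjacency (\<lambda>u v. (u, v) \<in> arcs_ends G)"
proof
  show "(v, u) \<in> arcs_ends G" if "(u, v) \<in> arcs_ends G" for u v
    using that sym_arcs by (auto simp: symmetric_def dest: symD)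
  show "(u, u) \<notin> arcs_ends G" for u
    using no_loops by (auto simp: arcs_ends_conv)
qed

lemma (in graph) graph_induce_subgraph:
  assumes "S \<subseteq> verts G"
  shows "graph (G \<restriction> S)"
proof -
  have ind: "induced_subgraph (G \<restriction> S) G"
    using assms by (rule induced_induce)
  interpret H: digraph "G \<restriction> S"
    using ind by (rule digraphI_induced)
  show ?thesis
    using induced_graph_imp_symmetric[OF sym_arcs ind] by (rule H.graphI)
qed

lemma arcs_ends_induce_subgraph:
  "arcs_ends (G \<restriction> S) = {(u, v) \<in> arcs_ends G. u \<in> S \<and> v \<in> S}"
  by (auto simp: arcs_ends_conv induce_subgraph_def)

lemma (in graph) hole_of_induced_cycle:
  assumes "adjacency.induced_cycle (\<lambda>u v. (u, v) \<in> arcs_ends G) xs"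
  shows "hole (length xs) (G \<restriction> set xs) G"
proof -
  interpret adjacency "\<lambda>u v. (u, v) \<in> arcs_ends G"
    by (rule adjacency_arcs_ends)
  let ?n = "length xs"
  have n: "?n \<ge> 4" and dist: "distinct xs"
    and adj: "\<And>i j. i < j \<Longrightarrow> j < ?n \<Longrightarrow>
      (xs ! i, xs ! j) \<in> arcs_ends G \<longleftrightarrow> j = Suc i \<or> i = 0 \<and> Suc j = ?n"
    using assms by (auto simp: induced_cycle_def)
  have succ: "(xs ! i, xs ! (Suc i mod ?n)) \<in> arcs_ends G" if "i < ?n" for i
  proof (cases "Suc i = ?n")
    case True
    then have "(xs ! 0, xs ! i) \<in> arcs_ends G"
      using adj[of 0 i] n by auto
    then show ?thesis
      using True adj_sym by auto
  next
    case False
    then show ?thesis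
      using adj[of i "Suc i"] that by auto
  qed
  have sub: "set xs \<subseteq> verts G"
    using adj_in_verts(1)[OF succ] by (auto simp: in_set_conv_nth)
  have ind: "induced_subgraph (G \<restriction> set xs) G"
    using sub by (rule induced_induce)
  let ?E = "\<Union>i<?n. {(xs ! i, xs ! (Suc i mod ?n)), (xs ! (Suc i mod ?n), xs ! i)}"
  have fwd: "(xs ! i, xs ! j) \<in> ?E \<and> (xs ! j, xs ! i) \<in> ?E"
    if ij: "i < j" "j < ?n" "(xs ! i, xs ! j) \<in> arcs_ends G" for i j
  proof -
    \<comment> \<open>The second case is the closing edge with \<open>i = 0\<close> and
      \<open>j\<close> the last index.\<close>
    consider "j = Suc i mod ?n" | "i = Suc j mod ?n"
      using adj[OF ij(1,2)] ij by force
    then show ?thesis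
    proof cases
      case 1
      have "i < ?n" using ij by simp
      with 1 show ?thesis by blast
    next
      case 2
      with ij(2) show ?thesis by blast
    qed
  qed
  have "arcs_ends (G \<restriction> set xs) = ?E"
  proof (intro equalityI subsetI)
    fix p assume p: "p \<in> arcs_ends (G \<restriction> set xs)"
    then obtain i j where ij: "i < ?n" "j < ?n" "p = (xs ! i, xs ! j)" "(xs ! i, xs ! j) \<in> arcs_ends G"
      by (auto simp: arcs_ends_induce_subgraph in_set_conv_nth)
    then consider "i < j" | "j < i"
      using adj_irrefl by (cases i j rule: linorder_cases) auto
    then show "p \<in> ?E"
    proof cases
      case 1
      then show ?thesis
        using fwd[OF 1 ij(2,4)] by (simp only: ij(3))
    next
      case 2
      then show ?thesis
        using fwd[OF 2 ij(1) adj_sym[OF ij(4)]] by (simp only: ij(3))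
    qed
  next
    fix p assume "p \<in> ?E"
    then obtain i where i: "i < ?n"
      "p = (xs ! i, xs ! (Suc i mod ?n)) \<or> p = (xs ! (Suc i mod ?n), xs ! i)"
      by blast
    moreover have "Suc i mod ?n < ?n"
      using n by (intro mod_less_divisor) linarith
    ultimately show "p \<in> arcs_ends (G \<restriction> set xs)"
      using succ[OF i(1)] adj_sym by (auto simp: arcs_ends_induce_subgraph)
  qed
  moreover have "graph (G \<restriction> set xs)"
    using sub by (rule graph_induce_subgraph)
  ultimately have "cycle_graph ?n (G \<restriction> set xs)"
    unfolding cycle_graph_def using n dist by (auto intro!: exI[of _ xs])
  then show ?thesis
    using n ind by (simp add: hole_def)
qed

lemma (in graph) complete_digraph_of_triangle:
  assumes "(a, b) \<in> arcs_ends G" "(b, c) \<in> arcs_ends G" "(c, a) \<in> arcs_ends G"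
  shows "subgraph (G \<restriction> {a, b, c}) G" "complete_digraph 3 (G \<restriction> {a, b, c})"
proof -
  interpret adjacency "\<lambda>u v. (u, v) \<in> arcs_ends G"
    by (rule adjacency_arcs_ends)
  have sub: "{a, b, c} \<subseteq> verts G"
    using adj_in_verts(1)[OF assms(1)] adj_in_verts(1)[OF assms(2)] adj_in_verts(1)[OF assms(3)] by simp
  then show "subgraph (G \<restriction> {a, b, c}) G"
    using induced_induce by (auto simp: induced_subgraph_def)
  have "a \<noteq> b" "b \<noteq> c" "c \<noteq> a"
    using assms adj_irrefl by auto
  then show "complete_digraph 3 (G \<restriction> {a, b, c})"
    using graph_induce_subgraph[OF sub] assms assms[THEN adj_sym] adj_irrefl
    unfolding complete_digraph_def arcs_ends_induce_subgraph by auto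
qed

theorem mainTheorem2:
  fixes G :: "('a, 'b) pre_digraph" and l :: nat
  assumes "l \<ge> 2"
    and "graph G"
    and "triangle_free G"
    and "\<not> (\<exists>H. hole 5 H G)"
    and "\<not> (\<exists>n H. odd n \<and> n > 2 * l + 1 \<and> hole n H G)"
  shows "chromatic_number G \<le> (l + 1) * 4 ^ (l - 1)"
proof -
  interpret graph G by fact
  \<comment> \<open>In general \<open>m + 4 = 2 * l + 2\<close> is just above the longest odd hole.
    For \<open>l = 2\<close> excluding 5-holes leaves no odd hole at all, so \<open>m = 0\<close> is
    possible; \<open>m = 2\<close> would give 16 colours, more than the 12 allowed.\<close>
  define m where "m = (if l = 2 then 0 else 2 * l - 2)"
  interpret adjacency "\<lambda>u v. (u, v) \<in> arcs_ends G"
    by (rule adjacency_arcs_ends)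
  have no_hole: "n \<noteq> 5" "odd n \<Longrightarrow> n \<le> 2 * l + 1" if "induced_cycle xs" "length xs = n" for xs n
    using hole_of_induced_cycle[OF that(1)] that(2) assms(4,5) by (auto simp: not_less[symmetric])
  interpret odd_hole_bounded "\<lambda>u v. (u, v) \<in> arcs_ends G" m
  proof
    show "(c, a) \<notin> arcs_ends G" if "(a, b) \<in> arcs_ends G" "(b, c) \<in> arcs_ends G" for a b c
      using complete_digraph_of_triangle[OF that] assms(3) unfolding triangle_free_def by blast
    show "length xs \<noteq> 5" if "induced_cycle xs" for xs
      using no_hole(1)[OF that refl] .
    show "even (length xs)" if xs: "induced_cycle xs" "length xs \<ge> m + 4" for xs
    proof (rule ccontr)
      assume "odd (length xs)"
      then have "length xs \<le> 2 * l + 1" "length xs \<noteq> 5" "length xs \<noteq> 4"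
        using no_hole[OF xs(1) refl] by auto
      then show False
        using xs(2) assms(1) by (auto simp: m_def split: if_splits)
    qed
  qed
  have "4 * m + 8 \<le> (l + 1) * 4 ^ (l - 1)"
  proof (cases "l = 2")
    case False
    then have "l \<ge> 3"
      using assms(1) by simp
    \<comment> \<open>For \<open>m = 2 * l - 2\<close> the number \<open>4 * m + 8\<close> is
      \<open>8 * l\<close>.\<close>
    then have "8 * l \<le> (l + 1) * 4 ^ (l - 1)"
    proof (induction l rule: dec_induct)
      case (step n)
      then obtain k where "n = Suc k"
        by (cases n) auto
      with step show ?case
        by simp
    qed simp
    then show ?thesis
      using False assms(1) by (simp add: m_def)
  qed (simp add: m_def)
  then have "colourable (verts G) ((l + 1) * 4 ^ (l - 1))"
    using colourable_linear colourable_mono by blast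
  then obtain c where "\<forall>v\<in>verts G. c v < (l + 1) * 4 ^ (l - 1)"
    "\<forall>u\<in>verts G. \<forall>v\<in>verts G. (u, v) \<in> arcs_ends G \<longrightarrow> c u \<noteq> c v"
    unfolding colourable_def by (elim exE conjE) (rule that)
  then have "proper_colouring ((l + 1) * 4 ^ (l - 1)) G c"
    unfolding proper_colouring_def using adj_in_verts by blast
  then show ?thesis
    unfolding chromatic_number_def by (intro Least_le exI)
qed

end
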